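(* Let $n\ge 0$. Any choice of contractible submodels on $[n]$ (relative to any interval partition $\mathfrak p$ of $[n]$) extends uniquely to a model structure on $[n]$: there is exactly one model structure on $[n]$ whose weak equivalences are the morphisms $X\to Y$ with $X$ and $Y$ in the same block of $\mathfrak p$, and whose acyclic fibrations (respectively acyclic cofibrations) are precisely the morphisms lying in a block that are acyclic fibrations (respectively acyclic cofibrations) of the chosen contractible model structure on that block.
   Context: $[n]$ denotes the poset $\{0<1<\dots<n\}$ regarded as a category (a unique morphism $i\to j$ iff $i\le j$). A weak factorization system on a category is a pair $(\mathcal L,\mathcal R)$ of classes of morphisms such that every morphism factors as $pi$ with $i\in\mathcal L$, $p\in\mathcal R$; every $i\in\mathcal L$ has the left lifting property with respect to every $p\in\mathcal R$; and both classes are closed under retracts. A model structure on a category with finite limits and colimits is a triple $(\mathsf W,\mathsf C,\mathsf F)$ of classes of morphisms such that $\mathsf W$ satisfies 2-out-of-3 and, with $\mathsf{AF}=\mathsf W\cap\mathsf F$ (acyclic fibrations) and $\mathsf{AC}=\mathsf W\cap\mathsf C$ (acyclic cofibrations), $(\mathsf C,\mathsf{AF})$ and $(\mathsf{AC},\mathsf F)$ are weak factorization systems. A model structure is contractible if every morphism is a weak equivalence. An interval partition of $[n]$ is a partition of $\{0,\dots,n\}$ into nonempty intervals (blocks) $[0,a_1]\amalg[a_1+1,a_2]\amalg\cdots\amalg[a_k+1,n]$. A choice of contractible submodels on $[n]$ relative to an interval partition is a choice, for each block (viewed as a full subcategory, hence isomorphic to some $[r]$), of a contractible model structure on that bloc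k. *)

theory Defs
  imports Main "HOL-Library.Disjoint_Sets"
begin

text \<open>Small categories. \<open>Comp C g f\<close> is the composite written g after f; its value matters only
  when \<open>Cod C f = Dom C g\<close>.\<close>

record ('o, 'a) category =
  Obj :: "'o set"
  Arr :: "'a set"
  Dom :: "'a \<Rightarrow> 'o"
  Cod :: "'a \<Rightarrow> 'o"
  Ident :: "'o \<Rightarrow> 'a"
  Comp :: "'a \<Rightarrow> 'a \<Rightarrow> 'a"

definition hom :: "('o, 'a) category \<Rightarrow> 'o \<Rightarrow> 'o \<Rightarrow> 'a set" where
  "hom C x y = {f \<in> Arr C. Dom C f = x \<and> Cod C f = y}"

locale category =
  fixes C :: "('o, 'a) category"
  assumes Dom_in_Obj: "f \<in> Arr C \<Longrightarrow> Dom C f \<in> Obj C"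
    and Cod_in_Obj: "f \<in> Arr C \<Longrightarrow> Cod C f \<in> Obj C"
    and Ident_in_hom: "x \<in> Obj C \<Longrightarrow> Ident C x \<in> hom C x x"
    and Comp_in_hom: "f \<in> hom C x y \<Longrightarrow> g \<in> hom C y z \<Longrightarrow> Comp C g f \<in> hom C x z"
    and Comp_Ident: "f \<in> hom C x y \<Longrightarrow> Comp C f (Ident C x) = f"
    and Ident_Comp: "f \<in> hom C x y \<Longrightarrow> Comp C (Ident C y) f = f"
    and Comp_assoc: "f \<in> hom C w x \<Longrightarrow> g \<in> hom C x y \<Longrightarrow> h \<in> hom C y z \<Longrightarrow>
           Comp C h (Comp C g f) = Comp C (Comp C h g) f"

definition opposite :: "('o, 'a) category \<Rightarrow> ('o, 'a) category" where
  "opposite C = \<lparr>Obj = Obj C, Arr = Arr C, Dom = Cod C, Cod = Dom C, Ident = Ident C,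
                 Comp = (\<lambda>g f. Comp C f g)\<rparr>"

definition full_subcategory :: "('o, 'a) category \<Rightarrow> 'o set \<Rightarrow> ('o, 'a) category" where
  "full_subcategory C S = C\<lparr>Obj := S, Arr := {f \<in> Arr C. Dom C f \<in> S \<and> Cod C f \<in> S}\<rparr>"

definition is_functor ::
  "('i, 'b) category \<Rightarrow> ('o, 'a) category \<Rightarrow> ('i \<Rightarrow> 'o) \<Rightarrow> ('b \<Rightarrow> 'a) \<Rightarrow> bool" where
  "is_functor J C Fo Fa \<longleftrightarrow>
     (\<forall>x\<in>Obj J. Fo x \<in> Obj C) \<and>
     (\<forall>f\<in>Arr J. Fa f \<in> hom C (Fo (Dom J f)) (Fo (Cod J f))) \<and>
     (\<forall>x\<in>Obj J. Fa (Ident J x) = Ident C (Fo x)) \<and>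
     (\<forall>f\<in>Arr J. \<forall>g\<in>Arr J. Cod J f = Dom J g \<longrightarrow> Fa (Comp J g f) = Comp C (Fa g) (Fa f))"

definition is_cone ::
  "('i, 'b) category \<Rightarrow> ('o, 'a) category \<Rightarrow> ('i \<Rightarrow> 'o) \<Rightarrow> ('b \<Rightarrow> 'a) \<Rightarrow> 'o \<Rightarrow> ('i \<Rightarrow> 'a) \<Rightarrow> bool" where
  "is_cone J C Fo Fa X \<pi> \<longleftrightarrow>
     X \<in> Obj C \<and> (\<forall>j\<in>Obj J. \<pi> j \<in> hom C X (Fo j)) \<and>
     (\<forall>f\<in>Arr J. Comp C (Fa f) (\<pi> (Dom J f)) = \<pi> (Cod J f))"

definition is_limit ::
  "('i, 'b) category \<Rightarrow> ('o, 'a) category \<Rightarrow> ('i \<Rightarrow> 'o) \<Rightarrow> ('b \<Rightarrow> 'a) \<Rightarrow> 'o \<Rightarrow> ('i \<Rightarrow> 'a) \<Rightarrow> bool" where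
  "is_limit J C Fo Fa X \<pi> \<longleftrightarrow>
     is_cone J C Fo Fa X \<pi> \<and>
     (\<forall>Y \<rho>. is_cone J C Fo Fa Y \<rho> \<longrightarrow>
        (\<exists>!h. h \<in> hom C Y X \<and> (\<forall>j\<in>Obj J. Comp C (\<pi> j) h = \<rho> j)))"

text \<open>Every finite category is isomorphic to one whose objects and arrows are natural numbers,
  so it suffices to let the diagram shape range over those.\<close>

definition has_finite_limits :: "('o, 'a) category \<Rightarrow> bool" where
  "has_finite_limits C \<longleftrightarrow>
     (\<forall>(J :: (nat, nat) category) Fo Fa.
        category J \<and> finite (Obj J) \<and> finite (Arr J) \<and> is_functor J C Fo Fa \<longrightarrow>
        (\<exists>X \<pi>. is_limit J C Fo Fa X \<pi>))"

definition has_finite_colimits :: "('o, 'a) category \<Rightarrow> bool" where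
  "has_finite_colimits C \<longleftrightarrow> has_finite_limits (opposite C)"

definition lifts :: "('o, 'a) category \<Rightarrow> 'a \<Rightarrow> 'a \<Rightarrow> bool" where
  "lifts C i p \<longleftrightarrow>
     (\<forall>u \<in> hom C (Dom C i) (Dom C p). \<forall>v \<in> hom C (Cod C i) (Cod C p).
        Comp C p u = Comp C v i \<longrightarrow>
        (\<exists>h \<in> hom C (Cod C i) (Dom C p). Comp C h i = u \<and> Comp C p h = v))"

text \<open>\<open>f\<close> is a retract of \<open>g\<close> in the arrow category: \<open>(s, s')\<close> is the section from \<open>f\<close> to \<open>g\<close>
  and \<open>(r, r')\<close> the retraction from \<open>g\<close> to \<open>f\<close>.\<close>

definition retract_of :: "('o, 'a) category \<Rightarrow> 'a \<Rightarrow> 'a \<Rightarrow> bool" where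
  "retract_of C f g \<longleftrightarrow> f \<in> Arr C \<and> g \<in> Arr C \<and>
     (\<exists>s \<in> hom C (Dom C f) (Dom C g). \<exists>s' \<in> hom C (Cod C f) (Cod C g).
      \<exists>r \<in> hom C (Dom C g) (Dom C f). \<exists>r' \<in> hom C (Cod C g) (Cod C f).
        Comp C g s = Comp C s' f \<and> Comp C f r = Comp C r' g \<and>
        Comp C r s = Ident C (Dom C f) \<and> Comp C r' s' = Ident C (Cod C f))"

definition closed_under_retracts :: "('o, 'a) category \<Rightarrow> 'a set \<Rightarrow> bool" where
  "closed_under_retracts C K \<longleftrightarrow> (\<forall>f g. retract_of C f g \<and> g \<in> K \<longrightarrow> f \<in> K)"

definition weak_factorization_system :: "('o, 'a) category \<Rightarrow> 'a set \<Rightarrow> 'a set \<Rightarrow> bool" where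
  "weak_factorization_system C L R \<longleftrightarrow>
     L \<subseteq> Arr C \<and> R \<subseteq> Arr C \<and>
     (\<forall>f\<in>Arr C. \<exists>i\<in>L. \<exists>p\<in>R. Cod C i = Dom C p \<and> f = Comp C p i) \<and>
     (\<forall>i\<in>L. \<forall>p\<in>R. lifts C i p) \<and>
     closed_under_retracts C L \<and> closed_under_retracts C R"

definition two_out_of_three :: "('o, 'a) category \<Rightarrow> 'a set \<Rightarrow> bool" where
  "two_out_of_three C K \<longleftrightarrow>
     (\<forall>f\<in>Arr C. \<forall>g\<in>Arr C. Cod C f = Dom C g \<longrightarrow>
        (f \<in> K \<and> g \<in> K \<longrightarrow> Comp C g f \<in> K) \<and>
        (f \<in> K \<and> Comp C g f \<in> K \<longrightarrow> g \<in> K) \<and>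
        (g \<in> K \<and> Comp C g f \<in> K \<longrightarrow> f \<in> K))"

record 'a model =
  Weq :: "'a set"
  Cof :: "'a set"
  Fib :: "'a set"

definition acyclic_fib :: "'a model \<Rightarrow> 'a set" where
  "acyclic_fib M = Weq M \<inter> Fib M"

definition acyclic_cof :: "'a model \<Rightarrow> 'a set" where
  "acyclic_cof M = Weq M \<inter> Cof M"

definition model_structure :: "('o, 'a) category \<Rightarrow> 'a model \<Rightarrow> bool" where
  "model_structure C M \<longleftrightarrow>
     category C \<and> has_finite_limits C \<and> has_finite_colimits C \<and>
     Weq M \<subseteq> Arr C \<and> Cof M \<subseteq> Arr C \<and> Fib M \<subseteq> Arr C \<and>
     two_out_of_three C (Weq M) \<and>
     weak_factorization_system C (Cof M) (acyclic_fib M) \<and>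
     weak_factorization_system C (acyclic_cof M) (Fib M)"

definition contractible_model_structure :: "('o, 'a) category \<Rightarrow> 'a model \<Rightarrow> bool" where
  "contractible_model_structure C M \<longleftrightarrow> model_structure C M \<and> Weq M = Arr C"

text \<open>The poset \<open>0 < 1 < ... < n\<close> as a category; the unique morphism from \<open>i\<close> to \<open>j\<close> is the
  pair \<open>(i, j)\<close>.\<close>

definition ordinal_category :: "nat \<Rightarrow> (nat, nat \<times> nat) category" where
  "ordinal_category n =
     \<lparr>Obj = {0..n}, Arr = {(i, j). i \<le> j \<and> j \<le> n}, Dom = fst, Cod = snd,
      Ident = (\<lambda>i. (i, i)), Comp = (\<lambda>g f. (fst f, snd g))\<rparr>"

definition interval_partition :: "nat \<Rightarrow> nat set set \<Rightarrow> bool" where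
  "interval_partition n P \<longleftrightarrow> partition_on {0..n} P \<and> (\<forall>B\<in>P. \<exists>a b. B = {a..b})"

text \<open>\<open>S B\<close> is the contractible model structure chosen on the block \<open>B\<close>; values of \<open>S\<close> at sets
  that are not blocks are irrelevant.\<close>

definition contractible_submodels :: "nat \<Rightarrow> nat set set \<Rightarrow> (nat set \<Rightarrow> (nat \<times> nat) model) \<Rightarrow> bool" where
  "contractible_submodels n P S \<longleftrightarrow>
     (\<forall>B\<in>P. contractible_model_structure (full_subcategory (ordinal_category n) B) (S B))"

end

theory Submission imports Defs begin

text \<open>In a poset a lifting problem of \<open>a \<le> b\<close> against \<open>c \<le> d\<close> exists iff \<open>a \<le> c\<close> and \<open>b \<le> d\<close>,
  and is solved iff \<open>b \<le> c\<close>; retracts are equalities, so each half of a weak factorization system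
  is determined by the other through lifting. A contractible model structure amounts to one weak
  factorization system \<open>(L B, R B)\<close>. Hence the cofibrations and fibrations of an extension must be
  the morphisms lifting against \<open>\<Union>B. R B\<close> and \<open>\<Union>B. L B\<close>. They work: to factor \<open>x \<le> y\<close> with the
  right factor acyclic, let \<open>m\<close> be the least element of the block of \<open>y\<close>, factor
  \<open>max x m \<le> z \<le> y\<close> in that block, and use \<open>x \<le> z \<le> y\<close>; the other factorization is dual.
  Lifting between different blocks is automatic since blocks are intervals.\<close>

section \<open>Weak factorization systems on a poset\<close>

definition order_arrows :: "'a::order set \<Rightarrow> ('a \<times> 'a) set" where
  "order_arrows B = {(x, y). x \<in> B \<and> y \<in> B \<and> x \<le> y}"

definition order_lifts :: "'a::order \<times> 'a \<Rightarrow> 'a \<times> 'a \<Rightarrow> bool" where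
  "order_lifts i p \<longleftrightarrow> (fst i \<le> fst p \<longrightarrow> snd i \<le> snd p \<longrightarrow> snd i \<le> fst p)"

text \<open>The order-theoretic form of a weak factorization system;
  \<open>wfs_full_subcategory\<close> matches it with the categorical one.\<close>

definition order_wfs :: "'a::order set \<Rightarrow> ('a \<times> 'a) set \<Rightarrow> ('a \<times> 'a) set \<Rightarrow> bool" where
  "order_wfs B L R \<longleftrightarrow> L \<subseteq> order_arrows B \<and> R \<subseteq> order_arrows B \<and>
     (\<forall>(x, y)\<in>order_arrows B. \<exists>z. (x, z) \<in> L \<and> (z, y) \<in> R) \<and>
     (\<forall>i\<in>L. \<forall>p\<in>R. order_lifts i p)"

text \<open>The retract argument: factor \<open>x \<le> y\<close> as
  \<open>x \<le> z \<le> y\<close>. Lifting against the right factor gives \<open>y \<le> z\<close>,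
  so the arrow equals its own left factor.\<close>

lemma order_wfs_left:
  assumes "order_wfs B L R"
  shows "L = {i \<in> order_arrows B. \<forall>p\<in>R. order_lifts i p}"
proof (intro equalityI subsetI)
  fix i assume "i \<in> {i \<in> order_arrows B. \<forall>p\<in>R. order_lifts i p}"
  then obtain x y where i: "i = (x, y)" "(x, y) \<in> order_arrows B"
      "\<And>p. p \<in> R \<Longrightarrow> order_lifts (x, y) p"
    by (cases i) auto
  then obtain z where z: "(x, z) \<in> L" "(z, y) \<in> R"
    using assms unfolding order_wfs_def by fast
  have "order_lifts (x, y) (z, y)"
    using i(3) z(2) by blast
  moreover have "x \<le> z" "z \<le> y"
    using assms z by (auto simp: order_wfs_def order_arrows_def)
  ultimately have "z = y"
    by (auto simp: order_lifts_def)
  then show "i \<in> L"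
    using z(1) i(1) by simp
qed (use assms in \<open>auto simp: order_wfs_def\<close>)

text \<open>Dually, lifting of the left factor against the arrow collapses \<open>z\<close> to
  \<open>x\<close>.\<close>

lemma order_wfs_right:
  assumes "order_wfs B L R"
  shows "R = {p \<in> order_arrows B. \<forall>i\<in>L. order_lifts i p}"
proof (intro equalityI subsetI)
  fix p assume "p \<in> {p \<in> order_arrows B. \<forall>i\<in>L. order_lifts i p}"
  then obtain x y where p: "p = (x, y)" "(x, y) \<in> order_arrows B"
      "\<And>i. i \<in> L \<Longrightarrow> order_lifts i (x, y)"
    by (cases p) auto
  then obtain z where z: "(x, z) \<in> L" "(z, y) \<in> R"
    using assms unfolding order_wfs_def by fast
  have "order_lifts (x, z) (x, y)"
    using p(3) z(1) by blast
  moreover have "x \<le> z" "z \<le> y"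
    using assms z by (auto simp: order_wfs_def order_arrows_def)
  ultimately have "z = x"
    by (auto simp: order_lifts_def)
  then show "p \<in> R"
    using z(2) p(1) by simp
qed (use assms in \<open>auto simp: order_wfs_def\<close>)

section \<open>Gluing weak factorization systems along an interval partition\<close>

locale interval_wfs =
  fixes A :: "'a::linorder set" and P :: "'a set set" and L R :: "'a set \<Rightarrow> ('a \<times> 'a) set"
  assumes partition: "partition_on A P"
    and interval: "B \<in> P \<Longrightarrow> \<exists>a b. B = {a..b}"
    and block_wfs: "B \<in> P \<Longrightarrow> order_wfs B (L B) (R B)"
begin

definition acof :: "('a \<times> 'a) set" where
  "acof = (\<Union>B\<in>P. L B)"

definition afib :: "('a \<times> 'a) set" where
  "afib = (\<Union>B\<in>P. R B)"

definition weq :: "('a \<times> 'a) set" where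
  "weq = (\<Union>B\<in>P. order_arrows B)"

definition cof :: "('a \<times> 'a) set" where
  "cof = {i \<in> order_arrows A. \<forall>p\<in>afib. order_lifts i p}"

definition fib :: "('a \<times> 'a) set" where
  "fib = {p \<in> order_arrows A. \<forall>i\<in>acof. order_lifts i p}"

lemma block_subset: "B \<in> P \<Longrightarrow> B \<subseteq> A"
  using partition by (auto simp: partition_on_def)

lemma block_eq: "B \<in> P \<Longrightarrow> B' \<in> P \<Longrightarrow> x \<in> B \<Longrightarrow> x \<in> B' \<Longrightarrow> B = B'"
  using partition by (auto simp: partition_on_def disjoint_def)

text \<open>Makes lifting across blocks automatic: an unsolved lifting problem traps an endpoint of
  one arrow between the endpoints of the other, which puts both arrows in one block.\<close>

lemma block_convex: "B \<in> P \<Longrightarrow> x \<in> B \<Longrightarrow> y \<in> B \<Longrightarrow> x \<le> z \<Longrightarrow> z \<le> y \<Longrightarrow> z \<in> B"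
  using interval[of B] by auto

lemma block_arrows: "B \<in> P \<Longrightarrow> order_arrows B \<subseteq> order_arrows A"
  using block_subset by (auto simp: order_arrows_def)

lemma L_arrow: "B \<in> P \<Longrightarrow> (x, y) \<in> L B \<Longrightarrow> x \<in> B \<and> y \<in> B \<and> x \<le> y"
  using block_wfs[of B] by (auto simp: order_wfs_def order_arrows_def)

lemma R_arrow: "B \<in> P \<Longrightarrow> (x, y) \<in> R B \<Longrightarrow> x \<in> B \<and> y \<in> B \<and> x \<le> y"
  using block_wfs[of B] by (auto simp: order_wfs_def order_arrows_def)

lemma L_lifts_R: "B \<in> P \<Longrightarrow> (a, b) \<in> L B \<Longrightarrow> (c, d) \<in> R B \<Longrightarrow> a \<le> c \<Longrightarrow> b \<le> d \<Longrightarrow> b \<le> c"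
  using block_wfs[of B] unfolding order_wfs_def order_lifts_def by fastforce

text \<open>Enlarging the left factor downwards is harmless as long as no element of the block is
  passed on the way.\<close>

lemma cofI:
  assumes B: "B \<in> P" "(w, z) \<in> L B" and x: "x \<in> A" "x \<le> w" "\<And>c. c \<in> B \<Longrightarrow> x \<le> c \<Longrightarrow> w \<le> c"
  shows "(x, z) \<in> cof"
proof -
  have "z \<le> c" if "B' \<in> P" "(c, d) \<in> R B'" "x \<le> c" "z \<le> d" for B' c d
  proof (rule ccontr)
    assume "\<not> z \<le> c"
    \<comment> \<open>Failure of the lift means \<open>c < z \<le> d\<close>, so \<open>z\<close> is
      trapped in the block of the right arrow.\<close>
    then have "z \<in> B'"
      using block_convex[of B' c d z] R_arrow[of B' c d] that by auto
    then have "B' = B"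
      using B L_arrow block_eq that(1) by blast
    \<comment> \<open>Now \<open>c\<close> lies in \<open>B\<close>, so \<open>x \<le> c\<close>
      improves to \<open>w \<le> c\<close> and the lifting inside \<open>B\<close> applies to
      \<open>(w, z)\<close>.\<close>
    then show False
      using L_lifts_R[of B w z c d] B x(3) R_arrow[of B' c d] that \<open>\<not> z \<le> c\<close> by auto
  qed
  moreover have "z \<in> A" "x \<le> z"
    using B x(2) L_arrow block_subset by fastforce+
  ultimately show ?thesis
    using x(1) by (auto simp: cof_def afib_def order_arrows_def order_lifts_def)
qed

text \<open>Order dual of \<open>cofI\<close>: the upper end rises from \<open>w\<close> to
  \<open>y\<close> past no element of \<open>B\<close>, so an arrow of \<open>L B\<close> ending
  below \<open>y\<close> already ends below \<open>w\<close>.\<close>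

lemma fibI:
  assumes B: "B \<in> P" "(z, w) \<in> R B" and y: "y \<in> A" "w \<le> y" "\<And>b. b \<in> B \<Longrightarrow> b \<le> y \<Longrightarrow> b \<le> w"
  shows "(z, y) \<in> fib"
proof -
  have "b \<le> z" if "B' \<in> P" "(a, b) \<in> L B'" "a \<le> z" "b \<le> y" for B' a b
  proof (rule ccontr)
    assume "\<not> b \<le> z"
    then have "z \<in> B'"
      using block_convex[of B' a b z] L_arrow[of B' a b] that by auto
    then have "B' = B"
      using B R_arrow block_eq that(1) by blast
    then show False
      using L_lifts_R[of B a b z w] B y(3) L_arrow[of B' a b] that \<open>\<not> b \<le> z\<close> by auto
  qed
  moreover have "z \<in> A" "z \<le> y"
    using B y(2) R_arrow block_subset by fastforce+
  ultimately show ?thesis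
    using y(1) by (auto simp: fib_def acof_def order_arrows_def order_lifts_def)
qed

text \<open>Inside a block, lifting against \<open>R B\<close> alone already characterizes
  \<open>L B\<close>. The converse is \<open>cofI\<close> with the lower end left in place.\<close>

lemma acof_eq: "weq \<inter> cof = acof"
proof (intro equalityI subsetI)
  fix f assume "f \<in> weq \<inter> cof"
  then obtain B where "B \<in> P" "f \<in> order_arrows B" "\<forall>p\<in>R B. order_lifts f p"
    by (auto simp: weq_def cof_def afib_def)
  then show "f \<in> acof"
    using order_wfs_left[OF block_wfs] by (auto simp: acof_def)
next
  fix f assume "f \<in> acof"
  then obtain B where B: "B \<in> P" "f \<in> L B"
    by (auto simp: acof_def)
  then have "f \<in> order_arrows B"
    using block_wfs[OF B(1)] by (auto simp: order_wfs_def)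
  moreover have "(fst f, snd f) \<in> cof"
    using B calculation block_subset[OF B(1)] by (intro cofI[of B "fst f"]) (auto simp: order_arrows_def)
  ultimately show "f \<in> weq \<inter> cof"
    using B(1) by (auto simp: weq_def)
qed

text \<open>Dual to \<open>acof_eq\<close>, with \<open>order_wfs_right\<close> and
  \<open>fibI\<close>.\<close>

lemma afib_eq: "weq \<inter> fib = afib"
proof (intro equalityI subsetI)
  fix f assume "f \<in> weq \<inter> fib"
  then obtain B where "B \<in> P" "f \<in> order_arrows B" "\<forall>i\<in>L B. order_lifts i f"
    by (auto simp: weq_def fib_def acof_def)
  then show "f \<in> afib"
    using order_wfs_right[OF block_wfs] by (auto simp: afib_def)
next
  fix f assume "f \<in> afib"
  then obtain B where B: "B \<in> P" "f \<in> R B"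
    by (auto simp: afib_def)
  then have "f \<in> order_arrows B"
    using block_wfs[OF B(1)] by (auto simp: order_wfs_def)
  moreover have "(fst f, snd f) \<in> fib"
    using B calculation block_subset[OF B(1)] by (intro fibI[of B _ "snd f"]) (auto simp: order_arrows_def)
  ultimately show "f \<in> weq \<inter> fib"
    using B(1) by (auto simp: weq_def)
qed

lemma weq_subset: "weq \<subseteq> order_arrows A"
  using block_arrows by (auto simp: weq_def)

lemma block_factor:
  assumes "B \<in> P" "x \<in> B" "y \<in> B" "x \<le> y"
  obtains z where "(x, z) \<in> L B" "(z, y) \<in> R B"
  using block_wfs[OF assms(1)] assms unfolding order_wfs_def order_arrows_def by fast

lemma cof_afib_wfs: "order_wfs A cof afib"
proof -
  have "\<exists>z. (x, z) \<in> cof \<and> (z, y) \<in> afib" if "x \<in> A" "y \<in> A" "x \<le> y" for x y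
  proof -
    obtain B where B: "B \<in> P" "y \<in> B"
      using partition \<open>y \<in> A\<close> by (auto simp: partition_on_def)
    obtain m b where m: "B = {m..b}"
      using interval[OF B(1)] by blast
    \<comment> \<open>If \<open>x\<close> is already in the block of \<open>y\<close> it stays put;
      otherwise it is raised to the least element \<open>m\<close>.\<close>
    have "max x m \<in> B" "max x m \<le> y"
      using B m that by auto
    then obtain z where z: "(max x m, z) \<in> L B" "(z, y) \<in> R B"
      using block_factor B by blast
    \<comment> \<open>Every element of \<open>B\<close> is at least \<open>m\<close>, so one above
      \<open>x\<close> is also above \<open>max x m\<close>, as \<open>cofI\<close> demands.\<close>
    have "(x, z) \<in> cof"
      using B z that m by (intro cofI[of B "max x m"]) auto
    then show ?thesis
      using z B by (auto simp: afib_def)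
  qed
  moreover have "cof \<subseteq> order_arrows A"
    by (auto simp: cof_def)
  moreover have "afib \<subseteq> order_arrows A"
    using afib_eq weq_subset by blast
  ultimately show ?thesis
    by (auto simp: order_wfs_def order_arrows_def cof_def)
qed

lemma acof_fib_wfs: "order_wfs A acof fib"
proof -
  have "\<exists>z. (x, z) \<in> acof \<and> (z, y) \<in> fib" if "x \<in> A" "y \<in> A" "x \<le> y" for x y
  proof -
    obtain B where B: "B \<in> P" "x \<in> B"
      using partition \<open>x \<in> A\<close> by (auto simp: partition_on_def)
    obtain a m where m: "B = {a..m}"
      using interval[OF B(1)] by blast
    \<comment> \<open>Here \<open>m\<close> is the greatest element of the block of
      \<open>x\<close>, and \<open>y\<close> is lowered to it when it lies beyond.\<close>
    have "min y m \<in> B" "x \<le> min y m"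
      using B m that by auto
    then obtain z where z: "(x, z) \<in> L B" "(z, min y m) \<in> R B"
      using block_factor B by blast
    have "(z, y) \<in> fib"
      using B z that m by (intro fibI[of B _ "min y m"]) auto
    then show ?thesis
      using z B by (auto simp: acof_def)
  qed
  moreover have "fib \<subseteq> order_arrows A"
    by (auto simp: fib_def)
  moreover have "acof \<subseteq> order_arrows A"
    using acof_eq weq_subset by blast
  ultimately show ?thesis
    by (auto simp: order_wfs_def order_arrows_def fib_def)
qed

end

section \<open>From the categories of blocks to their orders\<close>

lemma ordinal_category_simps [simp]:
  "Obj (ordinal_category n) = {0..n}"
  "Arr (ordinal_category n) = order_arrows {0..n}"
  "Dom (ordinal_category n) = fst"
  "Cod (ordinal_category n) = snd"
  "Ident (ordinal_category n) = (\<lambda>i. (i, i))"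
  "Comp (ordinal_category n) = (\<lambda>g f. (fst f, snd g))"
  by (auto simp: ordinal_category_def order_arrows_def)

lemma full_subcategory_simps [simp]:
  "Obj (full_subcategory C S) = S"
  "Dom (full_subcategory C S) = Dom C"
  "Cod (full_subcategory C S) = Cod C"
  "Ident (full_subcategory C S) = Ident C"
  "Comp (full_subcategory C S) = Comp C"
  by (auto simp: full_subcategory_def)

lemma Arr_full_subcategory [simp]:
  assumes "B \<subseteq> {0..n}"
  shows "Arr (full_subcategory (ordinal_category n) B) = order_arrows B"
  using assms by (auto simp: full_subcategory_def order_arrows_def)

text \<open>Lets the results on hom-sets and weak factorization systems, proved for blocks,
  specialize to all of \<open>[n]\<close>.\<close>

lemma full_subcategory_all: "full_subcategory (ordinal_category n) {0..n} = ordinal_category n"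
  by (auto simp: full_subcategory_def ordinal_category_def)

lemma hom_full_subcategory:
  assumes "B \<subseteq> {0..n}"
  shows "hom (full_subcategory (ordinal_category n) B) x y =
    (if x \<in> B \<and> y \<in> B \<and> x \<le> y then {(x, y)} else {})"
  using assms by (auto simp: hom_def full_subcategory_def order_arrows_def)

lemma hom_ordinal_category:
  "hom (ordinal_category n) x y = (if x \<le> y \<and> y \<le> n then {(x, y)} else {})"
  using hom_full_subcategory[of "{0..n}" n x y] by (auto simp: full_subcategory_all)

lemma lifts_full_subcategory:
  assumes "B \<subseteq> {0..n}" "i \<in> order_arrows B" "p \<in> order_arrows B"
  shows "lifts (full_subcategory (ordinal_category n) B) i p \<longleftrightarrow> order_lifts i p"
  using assms(2,3)
  by (auto simp: lifts_def hom_full_subcategory[OF assms(1)] order_lifts_def order_arrows_def)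

text \<open>A retract diagram gives inequalities both ways between corresponding endpoints;
  antisymmetry makes the two arrows equal.\<close>

lemma closed_under_retracts_full_subcategory:
  assumes "B \<subseteq> {0..n}"
  shows "closed_under_retracts (full_subcategory (ordinal_category n) B) K"
  using assms
  by (auto simp: closed_under_retracts_def retract_of_def hom_full_subcategory split: if_splits)

lemma wfs_full_subcategory:
  assumes "B \<subseteq> {0..n}"
  shows "weak_factorization_system (full_subcategory (ordinal_category n) B) L R \<longleftrightarrow> order_wfs B L R"
proof -
  let ?C = "full_subcategory (ordinal_category n) B"
  have "(\<forall>i\<in>L. \<forall>p\<in>R. lifts ?C i p) \<longleftrightarrow> (\<forall>i\<in>L. \<forall>p\<in>R. order_lifts i p)"
    if "L \<subseteq> order_arrows B" "R \<subseteq> order_arrows B"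
    using that lifts_full_subcategory[OF assms] by blast
  \<comment> \<open>Factoring an arrow of a poset amounts to choosing the middle object.\<close>
  moreover have "(\<exists>i\<in>L. \<exists>p\<in>R. Cod ?C i = Dom ?C p \<and> f = Comp ?C p i) \<longleftrightarrow>
      (\<exists>z. (fst f, z) \<in> L \<and> (z, snd f) \<in> R)" for f
    by (cases f) force
  ultimately show ?thesis
    using closed_under_retracts_full_subcategory[OF assms]
    by (auto simp: weak_factorization_system_def order_wfs_def assms case_prod_unfold)
qed

lemma wfs_ordinal_category:
  "weak_factorization_system (ordinal_category n) L R \<longleftrightarrow> order_wfs {0..n} L R"
  using wfs_full_subcategory[of "{0..n}" n] by (simp add: full_subcategory_all)

section \<open>Finite limits, finite colimits and weak equivalences in \<open>[n]\<close>\<close>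

lemma category_ordinal_category: "category (ordinal_category n)"
  by unfold_locales (auto simp: hom_ordinal_category order_arrows_def split: if_splits)

lemma has_finite_limits_ordinal_category: "has_finite_limits (ordinal_category n)"
  unfolding has_finite_limits_def
proof (intro allI impI)
  fix J :: "(nat, nat) category" and Fo and Fa :: "nat \<Rightarrow> nat \<times> nat"
  assume J: "category J \<and> finite (Obj J) \<and> finite (Arr J) \<and> is_functor J (ordinal_category n) Fo Fa"
  \<comment> \<open>The limit is the infimum of the values; inserting \<open>n\<close> gives the
    terminal object for the empty diagram.\<close>
  define X where "X = Min (insert n (Fo ` Obj J))"
  have X: "X \<le> n" "\<And>j. j \<in> Obj J \<Longrightarrow> X \<le> Fo j"
    using J by (auto simp: X_def)
  have X_greatest: "y \<le> X" if "y \<le> n" "\<And>j. j \<in> Obj J \<Longrightarrow> y \<le> Fo j" for y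
    using J that by (auto simp: X_def)
  have Fo: "Fo j \<le> n" if "j \<in> Obj J" for j
    using J that by (auto simp: is_functor_def)
  have "is_cone J (ordinal_category n) Fo Fa X (\<lambda>j. (X, Fo j))"
    using J X Fo category.Dom_in_Obj[of J] category.Cod_in_Obj[of J]
    by (fastforce simp: is_cone_def is_functor_def hom_ordinal_category split: if_splits)
  moreover have "\<exists>!h. h \<in> hom (ordinal_category n) Y X \<and>
      (\<forall>j\<in>Obj J. Comp (ordinal_category n) (X, Fo j) h = \<rho> j)"
    if "is_cone J (ordinal_category n) Fo Fa Y \<rho>" for Y \<rho>
  proof -
    have \<rho>: "\<rho> j = (Y, Fo j) \<and> Y \<le> Fo j" if "j \<in> Obj J" for j
      using \<open>is_cone J (ordinal_category n) Fo Fa Y \<rho>\<close> that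
      by (auto simp: is_cone_def hom_ordinal_category split: if_splits)
    have "Y \<le> X"
      using X_greatest that \<rho> by (auto simp: is_cone_def)
    then show ?thesis
      using \<rho> X by (auto simp: hom_ordinal_category)
  qed
  ultimately show "\<exists>X \<pi>. is_limit J (ordinal_category n) Fo Fa X \<pi>"
    unfolding is_limit_def by blast
qed

lemma hom_opposite: "hom (opposite C) x y = hom C y x"
  by (auto simp: hom_def opposite_def)

lemma opposite_simps [simp]:
  "Obj (opposite C) = Obj C"
  "Comp (opposite C) = (\<lambda>g f. Comp C f g)"
  by (auto simp: opposite_def)

lemma has_finite_colimits_ordinal_category: "has_finite_colimits (ordinal_category n)"
  unfolding has_finite_colimits_def has_finite_limits_def
proof (intro allI impI)
  fix J :: "(nat, nat) category" and Fo and Fa :: "nat \<Rightarrow> nat \<times> nat"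
  let ?C = "opposite (ordinal_category n)"
  assume J: "category J \<and> finite (Obj J) \<and> finite (Arr J) \<and> is_functor J ?C Fo Fa"
  \<comment> \<open>Dually the supremum; inserting \<open>0\<close> gives the initial object of
    \<open>[n]\<close> for the empty diagram.\<close>
  define X where "X = Max (insert 0 (Fo ` Obj J))"
  have X: "\<And>j. j \<in> Obj J \<Longrightarrow> Fo j \<le> X"
    using J by (auto simp: X_def)
  have X_least: "X \<le> y" if "\<And>j. j \<in> Obj J \<Longrightarrow> Fo j \<le> y" for y
    using J that by (auto simp: X_def)
  have "X \<le> n"
    using J by (intro X_least) (auto simp: is_functor_def)
  then have "is_cone J ?C Fo Fa X (\<lambda>j. (Fo j, X))"
    using J X category.Dom_in_Obj[of J] category.Cod_in_Obj[of J]
    by (fastforce simp: is_cone_def is_functor_def hom_opposite hom_ordinal_category split: if_splits)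
  moreover have "\<exists>!h. h \<in> hom ?C Y X \<and> (\<forall>j\<in>Obj J. Comp ?C (Fo j, X) h = \<rho> j)"
    if "is_cone J ?C Fo Fa Y \<rho>" for Y \<rho>
  proof -
    have \<rho>: "\<rho> j = (Fo j, Y) \<and> Fo j \<le> Y" if "j \<in> Obj J" for j
      using \<open>is_cone J ?C Fo Fa Y \<rho>\<close> that
      by (auto simp: is_cone_def hom_opposite hom_ordinal_category split: if_splits)
    have "X \<le> Y" "Y \<le> n"
      using X_least that \<rho> by (auto simp: is_cone_def)
    then show ?thesis
      using \<rho> by (auto simp: hom_opposite hom_ordinal_category)
  qed
  ultimately show "\<exists>X \<pi>. is_limit J ?C Fo Fa X \<pi>"
    unfolding is_limit_def by blast
qed

text \<open>Any two of \<open>f\<close>, \<open>g\<close> and their composite share an object, so if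
  both lie in blocks, these blocks agree and contain all three objects.\<close>

lemma two_out_of_three_blocks:
  assumes "partition_on {0..n} P"
  shows "two_out_of_three (ordinal_category n) (\<Union>B\<in>P. order_arrows B)"
proof -
  have "B = B'" if "B \<in> P" "B' \<in> P" "x \<in> B" "x \<in> B'" for B B' x
    using assms that by (auto simp: partition_on_def disjoint_def)
  then show ?thesis
    unfolding two_out_of_three_def by (auto simp: order_arrows_def)
qed

section \<open>Model structures on \<open>[n]\<close> and the unique extension\<close>

lemma model_structure_ordinal_category:
  "model_structure (ordinal_category n) M \<longleftrightarrow>
     Weq M \<subseteq> order_arrows {0..n} \<and> two_out_of_three (ordinal_category n) (Weq M) \<and>
     order_wfs {0..n} (Cof M) (acyclic_fib M) \<and> order_wfs {0..n} (acyclic_cof M) (Fib M)"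
  unfolding model_structure_def wfs_ordinal_category
  using category_ordinal_category has_finite_limits_ordinal_category
    has_finite_colimits_ordinal_category
  by (auto simp: order_wfs_def)

text \<open>When every arrow is a weak equivalence, cofibrations and acyclic cofibrations coincide,
  so one system carries the data.\<close>

lemma contractible_wfs:
  assumes "B \<subseteq> {0..n}" "contractible_model_structure (full_subcategory (ordinal_category n) B) M"
  shows "order_wfs B (acyclic_cof M) (acyclic_fib M)"
proof -
  have "Cof M \<subseteq> Weq M"
    using assms(2) by (auto simp: contractible_model_structure_def model_structure_def)
  then have "acyclic_cof M = Cof M"
    by (auto simp: acyclic_cof_def)
  then show ?thesis
    using assms wfs_full_subcategory
    by (auto simp: contractible_model_structure_def model_structure_def)
qed

theorem theorem3p10:
  fixes n :: nat
    and P :: "nat set set"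
    and S :: "nat set \<Rightarrow> (nat \<times> nat) model"
  assumes "interval_partition n P"
    and "contractible_submodels n P S"
  shows "\<exists>!M. model_structure (ordinal_category n) M \<and>
           Weq M = {f \<in> Arr (ordinal_category n).
                      \<exists>B\<in>P. Dom (ordinal_category n) f \<in> B \<and> Cod (ordinal_category n) f \<in> B} \<and>
           acyclic_fib M = (\<Union>B\<in>P. acyclic_fib (S B)) \<and>
           acyclic_cof M = (\<Union>B\<in>P. acyclic_cof (S B))"
proof -
  have P: "partition_on {0..n} P" "\<And>B. B \<in> P \<Longrightarrow> \<exists>a b. B = {a..b}"
    using assms(1) by (auto simp: interval_partition_def)
  have sub: "B \<subseteq> {0..n}" if "B \<in> P" for B
    using P(1) that by (auto simp: partition_on_def)
  \<comment> \<open>With the acyclic classes as block data, \<open>acof\<close> and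
    \<open>afib\<close> become exactly the unions prescribed in the theorem.\<close>
  interpret interval_wfs "{0..n}" P "\<lambda>B. acyclic_cof (S B)" "\<lambda>B. acyclic_fib (S B)"
    using P assms(2) contractible_wfs[OF sub]
    by unfold_locales (auto simp: contractible_submodels_def)
  have weq: "{f \<in> Arr (ordinal_category n).
      \<exists>B\<in>P. Dom (ordinal_category n) f \<in> B \<and> Cod (ordinal_category n) f \<in> B} = weq"
    using sub by (fastforce simp: weq_def order_arrows_def)
  show ?thesis
    unfolding weq acof_def[symmetric] afib_def[symmetric]
  proof (rule ex1I)
    let ?M = "\<lparr>Weq = weq, Cof = cof, Fib = fib\<rparr>"
    have "acyclic_fib ?M = afib" "acyclic_cof ?M = acof"
      using afib_eq acof_eq by (simp_all add: acyclic_fib_def[of ?M] acyclic_cof_def[of ?M])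
    then show "model_structure (ordinal_category n) ?M \<and> Weq ?M = weq \<and>
        acyclic_fib ?M = afib \<and> acyclic_cof ?M = acof"
      using weq_subset cof_afib_wfs acof_fib_wfs two_out_of_three_blocks[OF P(1)]
      by (simp add: model_structure_ordinal_category flip: weq_def)
  next
    fix M
    assume M: "model_structure (ordinal_category n) M \<and> Weq M = weq \<and>
      acyclic_fib M = afib \<and> acyclic_cof M = acof"
    \<comment> \<open>\<open>Cof M\<close> is the left partner of \<open>afib\<close> and
      \<open>Fib M\<close> the right partner of \<open>acof\<close>; each is determined by
      lifting.\<close>
    then have "Cof M = cof" "Fib M = fib"
      using order_wfs_left[of "{0..n}" "Cof M" afib] order_wfs_right[of "{0..n}" acof "Fib M"]
      by (auto simp: model_structure_ordinal_category cof_def fib_def)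
    then show "M = \<lparr>Weq = weq, Cof = cof, Fib = fib\<rparr>"
      using M by (cases M) simp
  qed
qed

end
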